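(* Let $(\alpha,\beta)$ be a Bertrand curve pair in $\mathbb{R}^3$, $\beta=\alpha+\lambda N$, where $\alpha$ has Frenet frame $T,N,B$, curvature $\kappa$ and torsion $\tau$, and let $\theta$ be the angle with $T_\beta=\cos\theta\,T+\sin\theta\,B$. Then, with respect to the normal connection $D^\perp$, $$D^\perp_BT=\Big(\frac{1-\cos\theta}{\sin\theta}\Big)\kappa N,\qquad D^\perp_BN=-\Big(\frac{1-\cos\theta}{\sin\theta}\Big)\kappa T.$$
   Context: Setting. $\alpha:I\to\mathbb{R}^3$ is a smooth unit speed curve with arc-length parameter $s$, Frenet frame $T,N,B$, curvature $\kappa>0$ and torsion $\tau>0$, with $T'=\kappa N$, $N'=-\kappa T+\tau B$, $B'=-\tau N$. A prime denotes $d/ds$. A Bertrand curve pair $(\alpha,\beta)$ consists of $\alpha$ and a curve $\beta$ having the same principal normal lines at corresponding points; then $\beta(s)=\alpha(s)+\lambda N(s)$ with $\lambda$ a real constant, and there is a real constant $\mu$ with $\lambda\kappa+\mu\tau=1$. It is assumed that $\lambda\neq0$ and $\mu\neq 0$. Put $\vartheta=\|\beta'(s)\|=\tau\sqrt{\lambda^2+\mu^2}$. The Frenet frame of $\beta$ is $T_\beta=\beta'/\vartheta=\cos\theta\,T+\sin\theta\,B$, $N_\beta=N$, $B_\beta=-\sin\theta\,T+\cos\theta\,B$, where $\theta$ is a constant angle with $\sin\theta\neq0$. The curvature and torsion of $\beta$ are $$\kappa_\beta=\frac{\lambda\kappa-\sin^2\theta}{\lambda(1-\lambda\kappa)},\qquad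 \tau_\beta=\frac{\sin^2\theta}{\lambda^2\tau}.$$ The operators. $D_T$ acts on the Frenet vectors of $\alpha$ by $D_TT=\kappa N$, $D_TN=-\kappa T+\tau B$, $D_TB=-\tau N$. $D_{T_\beta}$ acts on the Frenet vectors of $\beta$ by $D_{T_\beta}T_\beta=\vartheta\kappa_\beta N_\beta$, $D_{T_\beta}N_\beta=-\vartheta\kappa_\beta T_\beta+\vartheta\tau_\beta B_\beta$, $D_{T_\beta}B_\beta=-\vartheta\tau_\beta N_\beta$. All are linear over constants. The operator $D_B$ on the Frenet vectors is the one determined by $D_{T_\beta}=D_{\cos\theta\,T+\sin\theta\,B}=\cos\theta\,D_T+\sin\theta\,D_B$. The normal connection in the direction $B$ is $D^\perp_BX=D_BX-\langle D_BX,B\rangle B$. *)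

theory Defs
  imports "HOL-Analysis.Analysis"
begin

text \<open>Derivatives are taken relative to the parameter interval \<open>I\<close>, so that
  \<open>I\<close> need not be open; at an endpoint they are one-sided.\<close>

definition parameter_interval :: "real set \<Rightarrow> bool" where
  "parameter_interval I \<longleftrightarrow> is_interval I \<and> interior I \<noteq> {}"

definition smooth_curve_on :: "real set \<Rightarrow> (real \<Rightarrow> real ^ 3) \<Rightarrow> bool" where
  "smooth_curve_on I \<gamma> \<longleftrightarrow>
     (\<exists>F :: nat \<Rightarrow> real \<Rightarrow> real ^ 3. (\<forall>s\<in>I. F 0 s = \<gamma> s) \<and>
        (\<forall>n. \<forall>s\<in>I. (F n has_vector_derivative F (Suc n) s) (at s within I)))"

text \<open>Frenet apparatus of a regular curve \<open>\<gamma>\<close> with speed \<open>v\<close>: a positively oriented orthonormal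
  frame satisfying the Frenet equations in the given parameter. The curvature \<open>\<kappa>\<close> is not required
  to be positive here. This is needed for the mate of a Bertrand curve, whose principal normal
  is oriented like that of the original curve, so that its curvature carries a sign.\<close>

definition frenet_apparatus ::
  "real set \<Rightarrow> (real \<Rightarrow> real ^ 3) \<Rightarrow> (real \<Rightarrow> real) \<Rightarrow>
   (real \<Rightarrow> real ^ 3) \<Rightarrow> (real \<Rightarrow> real ^ 3) \<Rightarrow> (real \<Rightarrow> real ^ 3) \<Rightarrow>
   (real \<Rightarrow> real) \<Rightarrow> (real \<Rightarrow> real) \<Rightarrow> bool" where
  "frenet_apparatus I \<gamma> v T N B \<kappa> \<tau> \<longleftrightarrow>
     (\<forall>s\<in>I. v s > 0 \<and>
        norm (T s) = 1 \<and> norm (N s) = 1 \<and> T s \<bullet> N s = 0 \<and> B s = cross3 (T s) (N s) \<and>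
        (\<gamma> has_vector_derivative v s *\<^sub>R T s) (at s within I) \<and>
        (T has_vector_derivative (v s * \<kappa> s) *\<^sub>R N s) (at s within I) \<and>
        (N has_vector_derivative (- (v s * \<kappa> s) *\<^sub>R T s + (v s * \<tau> s) *\<^sub>R B s)) (at s within I) \<and>
        (B has_vector_derivative (- (v s * \<tau> s) *\<^sub>R N s)) (at s within I))"

definition principal_normal_line ::
  "(real \<Rightarrow> real ^ 3) \<Rightarrow> (real \<Rightarrow> real ^ 3) \<Rightarrow> real \<Rightarrow> (real ^ 3) set" where
  "principal_normal_line \<gamma> N s = {\<gamma> s + t *\<^sub>R N s | t. True}"

text \<open>Corresponding points are those with the same parameter value.\<close>

definition bertrand_pair ::
  "real set \<Rightarrow> (real \<Rightarrow> real ^ 3) \<Rightarrow> (real \<Rightarrow> real ^ 3) \<Rightarrow>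
   (real \<Rightarrow> real ^ 3) \<Rightarrow> (real \<Rightarrow> real ^ 3) \<Rightarrow> bool" where
  "bertrand_pair I \<alpha> N \<beta> N\<^sub>\<beta> \<longleftrightarrow>
     (\<forall>s\<in>I. principal_normal_line \<alpha> N s = principal_normal_line \<beta> N\<^sub>\<beta> s)"

text \<open>The domain of the operators: the fields along the curve that are constant-coefficient
  combinations of the frame. Fields are total functions here, but only their values on \<open>I\<close> matter.\<close>

definition frame_span ::
  "real set \<Rightarrow> (real \<Rightarrow> real ^ 3) \<Rightarrow> (real \<Rightarrow> real ^ 3) \<Rightarrow> (real \<Rightarrow> real ^ 3) \<Rightarrow>
   (real \<Rightarrow> real ^ 3) set" where
  "frame_span I T N B =
     {X. \<exists>a b c. \<forall>s\<in>I. X s = a *\<^sub>R T s + b *\<^sub>R N s + c *\<^sub>R B s}"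

definition linear_over_constants ::
  "real set \<Rightarrow> (real \<Rightarrow> real ^ 3) set \<Rightarrow>
   ((real \<Rightarrow> real ^ 3) \<Rightarrow> (real \<Rightarrow> real ^ 3)) \<Rightarrow> bool" where
  "linear_over_constants I V D \<longleftrightarrow>
     (\<forall>X\<in>V. \<forall>Y\<in>V. (\<forall>s\<in>I. X s = Y s) \<longrightarrow> (\<forall>s\<in>I. D X s = D Y s)) \<and>
     (\<forall>X\<in>V. \<forall>Y\<in>V. \<forall>a b. \<forall>s\<in>I.
        D (\<lambda>u. a *\<^sub>R X u + b *\<^sub>R Y u) s = a *\<^sub>R D X s + b *\<^sub>R D Y s)"

text \<open>The derivation of the Frenet vectors along the tangent of a curve of speed \<open>v\<close>.\<close>

definition tangential_derivation ::
  "real set \<Rightarrow> (real \<Rightarrow> real) \<Rightarrow>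
   (real \<Rightarrow> real ^ 3) \<Rightarrow> (real \<Rightarrow> real ^ 3) \<Rightarrow> (real \<Rightarrow> real ^ 3) \<Rightarrow>
   (real \<Rightarrow> real) \<Rightarrow> (real \<Rightarrow> real) \<Rightarrow>
   ((real \<Rightarrow> real ^ 3) \<Rightarrow> (real \<Rightarrow> real ^ 3)) \<Rightarrow> bool" where
  "tangential_derivation I v T N B \<kappa> \<tau> D \<longleftrightarrow>
     linear_over_constants I (frame_span I T N B) D \<and>
     (\<forall>s\<in>I. D T s = (v s * \<kappa> s) *\<^sub>R N s \<and>
            D N s = - (v s * \<kappa> s) *\<^sub>R T s + (v s * \<tau> s) *\<^sub>R B s \<and>
            D B s = - (v s * \<tau> s) *\<^sub>R N s)"

text \<open>The normal connection in the direction of the unit field \<open>B\<close>, for \<open>D\<close> the derivation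
  in that direction.\<close>

definition normal_connection ::
  "(real \<Rightarrow> real ^ 3) \<Rightarrow> ((real \<Rightarrow> real ^ 3) \<Rightarrow> (real \<Rightarrow> real ^ 3)) \<Rightarrow>
   (real \<Rightarrow> real ^ 3) \<Rightarrow> (real \<Rightarrow> real ^ 3)" where
  "normal_connection B D X = (\<lambda>s. D X s - (D X s \<bullet> B s) *\<^sub>R B s)"

lemma parameter_interval_limit:
  assumes "parameter_interval I" and "s \<in> I"
  shows "at s within I \<noteq> bot"
proof -
  from assms(1) obtain x e where xe: "e > 0" "ball x e \<subseteq> I" 
    unfolding parameter_interval_def mem_interior by (metis all_not_in_conv mem_interior)
  then have "x \<in> I" "x + e/2 \<in> I" "x \<noteq> x + e/2"
    by (auto simp: subset_iff dist_real_def)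
  then have "\<not> (\<exists>y. I = {y})" by auto
  moreover have "connected I"
    using assms(1) by (simp add: parameter_interval_def is_interval_connected)
  ultimately have "s islimpt I"
    using connected_imp_perfect assms(2) by blast
  then show ?thesis by (simp add: trivial_limit_within)
qed

lemma frame_products:
  fixes T N B :: "real ^ 3"
  assumes "norm T = 1" "norm N = 1" "T \<bullet> N = 0" "B = cross3 T N"
  shows "T \<bullet> T = 1" "N \<bullet> N = 1" "N \<bullet> T = 0" "T \<bullet> B = 0" "B \<bullet> T = 0" "N \<bullet> B = 0" "B \<bullet> N = 0"
    "B \<bullet> B = 1" "cross3 B N = - T"
proof -
  show a: "T \<bullet> T = 1" "N \<bullet> N = 1" "N \<bullet> T = 0"
    using assms by (auto simp: norm_eq_1 inner_commute)
  show "T \<bullet> B = 0" "B \<bullet> T = 0" "N \<bullet> B = 0" "B \<bullet> N = 0"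
    using assms by (simp_all add: dot_cross_self inner_commute)
  show "B \<bullet> B = 1" using a assms by (simp add: dot_cross)
  have "cross3 B N = - cross3 N B" using cross_skew by blast
  also have "cross3 N B = T"
    using a assms by (simp add: Lagrange)
  finally show "cross3 B N = - T" .
qed

text \<open>The usual formulas for the speed, binormal, curvature and torsion of the mate follow from the
  definitions above.\<close>

lemma bertrand_mate_apparatus:
  assumes I: "parameter_interval I" "s \<in> I"
    and fa: "frenet_apparatus I \<alpha> (\<lambda>_. 1) T N B \<kappa> \<tau>"
    and fb: "frenet_apparatus I \<beta> v T\<^sub>\<beta> N\<^sub>\<beta> B\<^sub>\<beta> \<kappa>\<^sub>\<beta> \<tau>\<^sub>\<beta>"
    and tau: "\<tau> s > 0"
    and N: "\<forall>s\<in>I. N\<^sub>\<beta> s = N s"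
    and beta: "\<forall>s\<in>I. \<beta> s = \<alpha> s + lam *\<^sub>R N s"
    and nz: "lam \<noteq> 0" "\<mu> \<noteq> 0"
    and mu: "lam * \<kappa> s + \<mu> * \<tau> s = 1"
    and T: "\<forall>s\<in>I. T\<^sub>\<beta> s = cos \<theta> *\<^sub>R T s + sin \<theta> *\<^sub>R B s"
  shows "B\<^sub>\<beta> s = - sin \<theta> *\<^sub>R T s + cos \<theta> *\<^sub>R B s"
    and "v s = \<tau> s * sqrt (lam\<^sup>2 + \<mu>\<^sup>2)"
    and "\<kappa>\<^sub>\<beta> s = (lam * \<kappa> s - (sin \<theta>)\<^sup>2) / (lam * (1 - lam * \<kappa> s))"
    and "\<tau>\<^sub>\<beta> s = (sin \<theta>)\<^sup>2 / (lam\<^sup>2 * \<tau> s)"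
proof -
  define c d where cd: "c = cos \<theta>" "d = sin \<theta>"
  have cd1: "c\<^sup>2 + d\<^sup>2 = 1" by (simp add: cd)
  note lim = parameter_interval_limit[OF I]
  note a = fa[unfolded frenet_apparatus_def, rule_format, OF I(2), simplified]
  note b = fb[unfolded frenet_apparatus_def, rule_format, OF I(2), simplified]
  have fr: "norm (T s) = 1" "norm (N s) = 1" "T s \<bullet> N s = 0" "B s = cross3 (T s) (N s)"
    using a by auto
  note fp = frame_products[OF fr] fr(3)
  have v: "v s > 0" using b by auto
  have Bb: "B\<^sub>\<beta> s = - d *\<^sub>R T s + c *\<^sub>R B s" if "s \<in> I" for s
  proof -
    have g: "norm (T s) = 1" "norm (N s) = 1" "T s \<bullet> N s = 0" "B s = cross3 (T s) (N s)"
      using fa that by (auto simp: frenet_apparatus_def)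
    have "B\<^sub>\<beta> s = cross3 (T\<^sub>\<beta> s) (N\<^sub>\<beta> s)"
      using fb that by (simp add: frenet_apparatus_def)
    then show ?thesis
      using that g frame_products(9)[OF g]
      by (simp add: N T cd cross_add_left cross_mult_left)
  qed
  then show "B\<^sub>\<beta> s = - sin \<theta> *\<^sub>R T s + cos \<theta> *\<^sub>R B s" using I cd by auto
  have "((\<lambda>s. \<alpha> s + lam *\<^sub>R N s) has_vector_derivative
      T s + lam *\<^sub>R (- \<kappa> s *\<^sub>R T s + \<tau> s *\<^sub>R B s)) (at s within I)"
    using a by (auto intro!: derivative_eq_intros)
  then have "(\<beta> has_vector_derivative
      T s + lam *\<^sub>R (- \<kappa> s *\<^sub>R T s + \<tau> s *\<^sub>R B s)) (at s within I)"
    by (rule has_vector_derivative_transform[rotated 2]) (use I beta in auto)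
  then have "v s *\<^sub>R T\<^sub>\<beta> s = T s + lam *\<^sub>R (- \<kappa> s *\<^sub>R T s + \<tau> s *\<^sub>R B s)"
    using b vector_derivative_unique_within[OF lim] by blast
  then have e: "v s *\<^sub>R (c *\<^sub>R T s + d *\<^sub>R B s) =
      T s + lam *\<^sub>R (- \<kappa> s *\<^sub>R T s + \<tau> s *\<^sub>R B s)"
    using T I cd by simp
  have e1: "v s * c = 1 - lam * \<kappa> s"
    using arg_cong[OF e, of "\<lambda>x. x \<bullet> T s"] by (simp add: inner_simps fp)
  have e2: "v s * d = lam * \<tau> s"
    using arg_cong[OF e, of "\<lambda>x. x \<bullet> B s"] by (simp add: inner_simps fp)
  have e1': "v s * c = \<mu> * \<tau> s" using e1 mu by simp
  have "(v s)\<^sup>2 = (v s * c)\<^sup>2 + (v s * d)\<^sup>2"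
    using cd1 by (metis distrib_left mult.right_neutral power_mult_distrib)
  also have "\<dots> = (\<tau> s * sqrt (lam\<^sup>2 + \<mu>\<^sup>2))\<^sup>2"
    unfolding e1' e2 by (simp add: power_mult_distrib algebra_simps)
  finally show "v s = \<tau> s * sqrt (lam\<^sup>2 + \<mu>\<^sup>2)"
    using v tau by (smt (verit) power2_eq_imp_eq mult_nonneg_nonneg real_sqrt_ge_zero
        sum_power2_ge_zero)
  have "((\<lambda>s. c *\<^sub>R T s + d *\<^sub>R B s) has_vector_derivative
      (c *\<^sub>R (\<kappa> s *\<^sub>R N s) + d *\<^sub>R (- \<tau> s *\<^sub>R N s))) (at s within I)"
    using a by (auto intro!: derivative_eq_intros)
  then have "(T\<^sub>\<beta> has_vector_derivative
      (c *\<^sub>R (\<kappa> s *\<^sub>R N s) + d *\<^sub>R (- \<tau> s *\<^sub>R N s))) (at s within I)"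
    by (rule has_vector_derivative_transform[rotated 2]) (use I T cd in auto)
  then have "(v s * \<kappa>\<^sub>\<beta> s) *\<^sub>R N s = c *\<^sub>R (\<kappa> s *\<^sub>R N s) + d *\<^sub>R (- \<tau> s *\<^sub>R N s)"
    using b N I vector_derivative_unique_within[OF lim] by metis
  from arg_cong[OF this, of "\<lambda>x. x \<bullet> N s"]
  have k: "v s * \<kappa>\<^sub>\<beta> s = c * \<kappa> s - d * \<tau> s" by (simp add: inner_simps fp)
  have "((\<lambda>s. - d *\<^sub>R T s + c *\<^sub>R B s) has_vector_derivative
      (- d *\<^sub>R (\<kappa> s *\<^sub>R N s) + c *\<^sub>R (- \<tau> s *\<^sub>R N s))) (at s within I)"
    using a by (auto intro!: derivative_eq_intros)
  then have "(B\<^sub>\<beta> has_vector_derivative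
      (- d *\<^sub>R (\<kappa> s *\<^sub>R N s) + c *\<^sub>R (- \<tau> s *\<^sub>R N s))) (at s within I)"
    by (rule has_vector_derivative_transform[rotated 2]) (use I Bb in auto)
  moreover have "(B\<^sub>\<beta> has_vector_derivative - (v s * \<tau>\<^sub>\<beta> s) *\<^sub>R N s) (at s within I)"
    using b N I by simp
  ultimately have "- (v s * \<tau>\<^sub>\<beta> s) *\<^sub>R N s = - d *\<^sub>R (\<kappa> s *\<^sub>R N s) + c *\<^sub>R (- \<tau> s *\<^sub>R N s)"
    using vector_derivative_unique_within[OF lim] by metis
  from arg_cong[OF this, of "\<lambda>x. x \<bullet> N s"]
  have t: "v s * \<tau>\<^sub>\<beta> s = d * \<kappa> s + c * \<tau> s" by (simp add: inner_simps fp)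
  have "\<kappa>\<^sub>\<beta> s * (lam * (1 - lam * \<kappa> s)) = lam * \<kappa> s - d\<^sup>2"
    using k e1 e2 cd1 v by algebra
  moreover have "1 - lam * \<kappa> s \<noteq> 0" using e1 e1' tau nz by (metis less_irrefl mult_eq_0_iff)
  ultimately show "\<kappa>\<^sub>\<beta> s = (lam * \<kappa> s - (sin \<theta>)\<^sup>2) / (lam * (1 - lam * \<kappa> s))"
    using nz cd by (simp add: eq_divide_eq)
  have "v s * (\<tau>\<^sub>\<beta> s * (lam\<^sup>2 * \<tau> s)) = v s * d\<^sup>2"
    using t e1 e2 by algebra
  then have "\<tau>\<^sub>\<beta> s * (lam\<^sup>2 * \<tau> s) = d\<^sup>2" using v by simp
  then show "\<tau>\<^sub>\<beta> s = (sin \<theta>)\<^sup>2 / (lam\<^sup>2 * \<tau> s)"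
    using nz tau cd by (simp add: eq_divide_eq)
qed

end

theory Submission
  imports Defs
begin

text \<open>The derivative of the common principal normal, computed in both Frenet frames, gives
  \<open>D\<^sub>T\<^sub>\<beta> N = D\<^sub>T N\<close> and \<open>\<kappa> = v (\<kappa>\<^sub>\<beta> cos \<theta> + \<tau>\<^sub>\<beta> sin \<theta>)\<close>. Since \<open>T = cos \<theta> T\<^sub>\<beta> - sin \<theta> B\<^sub>\<beta>\<close>, the latter
  yields \<open>D\<^sub>T\<^sub>\<beta> T = \<kappa> N = D\<^sub>T T\<close>. Hence \<open>sin \<theta> D\<^sub>B X = (1 - cos \<theta>) D\<^sub>T X\<close> for \<open>X = T\<close> and \<open>X = N\<close>.\<close>

lemma frame_spanI:
  assumes "\<And>s. s \<in> I \<Longrightarrow> X s = a *\<^sub>R T s + b *\<^sub>R N s + c *\<^sub>R B s"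
  shows "X \<in> frame_span I T N B"
  using assms unfolding frame_span_def by blast

lemma frame_span_frame:
  "T \<in> frame_span I T N B" "N \<in> frame_span I T N B" "B \<in> frame_span I T N B"
proof -
  show "T \<in> frame_span I T N B" by (rule frame_spanI[where a = 1 and b = 0 and c = 0]) simp
  show "N \<in> frame_span I T N B" by (rule frame_spanI[where a = 0 and b = 1 and c = 0]) simp
  show "B \<in> frame_span I T N B" by (rule frame_spanI[where a = 0 and b = 0 and c = 1]) simp
qed

text \<open>Operators act on total functions, whereas a decomposition of a field is known only on
  \<open>I\<close>. The locality clause of \<open>linear_over_constants\<close> first replaces
  \<open>Z\<close> by the combination, and then linearity applies. Both clauses hold only inside
  \<open>V\<close>, hence the membership assumptions.\<close>

lemma linear_over_constants_combination:
  assumes "linear_over_constants I V D" "X \<in> V" "Y \<in> V" "Z \<in> V"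
    and "(\<lambda>u. a *\<^sub>R X u + b *\<^sub>R Y u) \<in> V"
    and "\<forall>s\<in>I. Z s = a *\<^sub>R X s + b *\<^sub>R Y s" "s \<in> I"
  shows "D Z s = a *\<^sub>R D X s + b *\<^sub>R D Y s"
proof -
  have "D Z s = D (\<lambda>u. a *\<^sub>R X u + b *\<^sub>R Y u) s"
    using assms(1)[unfolded linear_over_constants_def, THEN conjunct1, rule_format,
        OF assms(4,5) _ assms(7)] assms(6) by blast
  also have "\<dots> = a *\<^sub>R D X s + b *\<^sub>R D Y s"
    using assms(1)[unfolded linear_over_constants_def, THEN conjunct2] assms(2,3,7) by blast
  finally show ?thesis .
qed

text \<open>Used with \<open>x\<close> the derivative of a frame vector along the tangent of
  \<alpha> and \<open>y\<close> its derivative in the direction \<open>B\<close>. The left side is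
  \<open>x\<close> because the derivative along the tangent of \<beta> has the same value.\<close>

lemma eq_scaled_of_combination:
  fixes x y :: "'a::real_vector"
  assumes "x = cos \<theta> *\<^sub>R x + sin \<theta> *\<^sub>R y" "sin \<theta> \<noteq> 0"
  shows "y = ((1 - cos \<theta>) / sin \<theta>) *\<^sub>R x"
proof -
  have "sin \<theta> *\<^sub>R y = (1 - cos \<theta>) *\<^sub>R x"
    unfolding scaleR_left_diff_distrib scaleR_one eq_diff_eq add.commute[of "sin \<theta> *\<^sub>R y"]
    by (rule assms(1)[symmetric])
  then have "(1 / sin \<theta>) *\<^sub>R (sin \<theta> *\<^sub>R y) = (1 / sin \<theta>) *\<^sub>R ((1 - cos \<theta>) *\<^sub>R x)"
    by simp
  then show ?thesis using assms(2) by simp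
qed

theorem theorem2p2:
  fixes I :: "real set"
    and \<alpha> \<beta> T N B T\<^sub>\<beta> N\<^sub>\<beta> B\<^sub>\<beta> :: "real \<Rightarrow> real ^ 3"
    and \<kappa> \<tau> v \<kappa>\<^sub>\<beta> \<tau>\<^sub>\<beta> :: "real \<Rightarrow> real"
    and lam \<mu> \<theta> :: real
    and D\<^sub>T D\<^sub>T\<^sub>\<beta> D\<^sub>B :: "(real \<Rightarrow> real ^ 3) \<Rightarrow> (real \<Rightarrow> real ^ 3)"
  assumes "parameter_interval I"
    and "smooth_curve_on I \<alpha>" and "smooth_curve_on I \<beta>"
    and "frenet_apparatus I \<alpha> (\<lambda>_. 1) T N B \<kappa> \<tau>"
    and "\<forall>s\<in>I. \<kappa> s > 0" and "\<forall>s\<in>I. \<tau> s > 0"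
    and "frenet_apparatus I \<beta> v T\<^sub>\<beta> N\<^sub>\<beta> B\<^sub>\<beta> \<kappa>\<^sub>\<beta> \<tau>\<^sub>\<beta>"
    and "bertrand_pair I \<alpha> N \<beta> N\<^sub>\<beta>"
    and "\<forall>s\<in>I. N\<^sub>\<beta> s = N s"
    and "\<forall>s\<in>I. \<beta> s = \<alpha> s + lam *\<^sub>R N s"
    and "\<forall>s\<in>I. lam * \<kappa> s + \<mu> * \<tau> s = 1"
    and "lam \<noteq> 0" and "\<mu> \<noteq> 0"
    and "\<forall>s\<in>I. T\<^sub>\<beta> s = cos \<theta> *\<^sub>R T s + sin \<theta> *\<^sub>R B s"
    and "sin \<theta> \<noteq> 0"
    and "tangential_derivation I (\<lambda>_. 1) T N B \<kappa> \<tau> D\<^sub>T"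
    and "tangential_derivation I v T\<^sub>\<beta> N\<^sub>\<beta> B\<^sub>\<beta> \<kappa>\<^sub>\<beta> \<tau>\<^sub>\<beta> D\<^sub>T\<^sub>\<beta>"
    and "\<forall>X\<in>frame_span I T N B. \<forall>s\<in>I.
           D\<^sub>T\<^sub>\<beta> X s = cos \<theta> *\<^sub>R D\<^sub>T X s + sin \<theta> *\<^sub>R D\<^sub>B X s"
  shows "\<forall>s\<in>I.
           normal_connection B D\<^sub>B T s = (((1 - cos \<theta>) / sin \<theta>) * \<kappa> s) *\<^sub>R N s \<and>
           normal_connection B D\<^sub>B N s = - (((1 - cos \<theta>) / sin \<theta>) * \<kappa> s) *\<^sub>R T s"
proof (intro ballI)
  fix s assume s: "s \<in> I"
  define c d where cd: "c = cos \<theta>" "d = sin \<theta>"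
  have cd1: "c\<^sup>2 + d\<^sup>2 = 1" by (simp add: cd)
  define V where "V = frame_span I T\<^sub>\<beta> N\<^sub>\<beta> B\<^sub>\<beta>"
  have Bb: "B\<^sub>\<beta> u = - d *\<^sub>R T u + c *\<^sub>R B u" if "u \<in> I" for u
    unfolding cd using bertrand_mate_apparatus(1)[OF assms(1) that assms(4,7) _ assms(9,10,12,13) _ assms(14)]
      assms(6,11) that by simp
  have Tb: "T\<^sub>\<beta> u = c *\<^sub>R T u + d *\<^sub>R B u" if "u \<in> I" for u
    using assms(14) that by (simp add: cd)
  \<comment> \<open>The pair \<open>T\<^sub>\<beta>\<close>, \<open>B\<^sub>\<beta>\<close> is
    \<open>T\<close>, \<open>B\<close> rotated by \<theta> in the plane orthogonal to
    \<open>N\<close>; this is the inverse rotation. It is required because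
    \<open>D\<^sub>T\<^sub>\<beta>\<close> is prescribed on the frame of \<beta> only.\<close>
  have T: "T u = c *\<^sub>R T\<^sub>\<beta> u + (- d) *\<^sub>R B\<^sub>\<beta> u" if "u \<in> I" for u
  proof -
    have "c *\<^sub>R T\<^sub>\<beta> u + (- d) *\<^sub>R B\<^sub>\<beta> u = (c\<^sup>2 + d\<^sup>2) *\<^sub>R T u"
      by (simp add: Tb Bb that algebra_simps power2_eq_square)
    then show ?thesis using cd1 by simp
  qed
  note a = assms(4)[unfolded frenet_apparatus_def, rule_format, OF s, simplified]
  have fr: "norm (T s) = 1" "norm (N s) = 1" "T s \<bullet> N s = 0" "B s = cross3 (T s) (N s)"
    using a by auto
  note fp = frame_products[OF fr] fr(3)
  have Nb: "(N\<^sub>\<beta> has_vector_derivative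
      - (v s * \<kappa>\<^sub>\<beta> s) *\<^sub>R T\<^sub>\<beta> s + (v s * \<tau>\<^sub>\<beta> s) *\<^sub>R B\<^sub>\<beta> s) (at s within I)"
    using assms(7) s unfolding frenet_apparatus_def by blast
  have "(N\<^sub>\<beta> has_vector_derivative (- \<kappa> s *\<^sub>R T s + \<tau> s *\<^sub>R B s)) (at s within I)"
    by (rule has_vector_derivative_transform[of s I N\<^sub>\<beta> N]) (use a s assms(9) in auto)
  \<comment> \<open>The two normals agree on \<open>I\<close>, and each point of \<open>I\<close> is
    a limit point of \<open>I\<close>, so the derivative within \<open>I\<close> is unique.\<close>
  then have dN: "- (v s * \<kappa>\<^sub>\<beta> s) *\<^sub>R T\<^sub>\<beta> s + (v s * \<tau>\<^sub>\<beta> s) *\<^sub>R B\<^sub>\<beta> s = - \<kappa> s *\<^sub>R T s + \<tau> s *\<^sub>R B s"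
    by (rule vector_derivative_unique_within[OF parameter_interval_limit[OF assms(1) s] Nb])
  \<comment> \<open>The component along \<open>T\<close>: \<open>T\<^sub>\<beta>\<close> contributes
    \<open>c\<close> and \<open>B\<^sub>\<beta>\<close> contributes \<open>- d\<close>.\<close>
  have k: "c * (v s * \<kappa>\<^sub>\<beta> s) + d * (v s * \<tau>\<^sub>\<beta> s) = \<kappa> s"
    using arg_cong[OF dN, of "\<lambda>x. x \<bullet> T s"] by (simp add: inner_simps fp Tb Bb s algebra_simps)
  have lin: "linear_over_constants I V D\<^sub>T\<^sub>\<beta>"
    and Db: "D\<^sub>T\<^sub>\<beta> T\<^sub>\<beta> s = (v s * \<kappa>\<^sub>\<beta> s) *\<^sub>R N\<^sub>\<beta> s"
      "D\<^sub>T\<^sub>\<beta> N\<^sub>\<beta> s = - (v s * \<kappa>\<^sub>\<beta> s) *\<^sub>R T\<^sub>\<beta> s + (v s * \<tau>\<^sub>\<beta> s) *\<^sub>R B\<^sub>\<beta> s"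
      "D\<^sub>T\<^sub>\<beta> B\<^sub>\<beta> s = - (v s * \<tau>\<^sub>\<beta> s) *\<^sub>R N\<^sub>\<beta> s"
    using assms(17) s by (auto simp: tangential_derivation_def V_def)
  have Da: "D\<^sub>T T s = \<kappa> s *\<^sub>R N s" "D\<^sub>T N s = - \<kappa> s *\<^sub>R T s + \<tau> s *\<^sub>R B s"
    using assms(16) s by (auto simp: tangential_derivation_def)
  have frame: "T\<^sub>\<beta> \<in> V" "N\<^sub>\<beta> \<in> V" "B\<^sub>\<beta> \<in> V"
    unfolding V_def by (rule frame_span_frame)+
  have "D\<^sub>T\<^sub>\<beta> T s = c *\<^sub>R D\<^sub>T\<^sub>\<beta> T\<^sub>\<beta> s + (- d) *\<^sub>R D\<^sub>T\<^sub>\<beta> B\<^sub>\<beta> s"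
  proof (rule linear_over_constants_combination[OF lin frame(1,3) _ _ _ s])
    show "T \<in> V" "(\<lambda>u. c *\<^sub>R T\<^sub>\<beta> u + (- d) *\<^sub>R B\<^sub>\<beta> u) \<in> V"
      unfolding V_def by (rule frame_spanI[where a = c and b = 0 and c = "- d"]; simp add: T)+
  qed (use T in blast)
  also have "\<dots> = (c * (v s * \<kappa>\<^sub>\<beta> s) + d * (v s * \<tau>\<^sub>\<beta> s)) *\<^sub>R N s"
    using assms(9) s by (simp add: Db algebra_simps)
  finally have DbT: "D\<^sub>T\<^sub>\<beta> T s = D\<^sub>T T s" by (simp only: k Da)
  \<comment> \<open>\<open>N\<close> and \<open>N\<^sub>\<beta>\<close> may differ off
    \<open>I\<close>, so they cannot be rewritten into each other under the operator. The trivial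
    combination with coefficients 1 and 0 transfers the value on \<open>I\<close>.\<close>
  have "D\<^sub>T\<^sub>\<beta> N s = 1 *\<^sub>R D\<^sub>T\<^sub>\<beta> N\<^sub>\<beta> s + 0 *\<^sub>R D\<^sub>T\<^sub>\<beta> N\<^sub>\<beta> s"
  proof (rule linear_over_constants_combination[OF lin frame(2,2) _ _ _ s])
    show "N \<in> V" "(\<lambda>u. 1 *\<^sub>R N\<^sub>\<beta> u + 0 *\<^sub>R N\<^sub>\<beta> u) \<in> V"
      unfolding V_def by (rule frame_spanI[where a = 0 and b = 1 and c = 0]; simp add: assms(9))+
  qed (use assms(9) in simp)
  then have DbN: "D\<^sub>T\<^sub>\<beta> N s = D\<^sub>T N s"
    by (simp only: Db Da dN scaleR_one scaleR_zero_left add_0_right)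
  have DB: "D\<^sub>B X s = ((1 - cos \<theta>) / sin \<theta>) *\<^sub>R D\<^sub>T X s"
    if "X \<in> frame_span I T N B" "D\<^sub>T\<^sub>\<beta> X s = D\<^sub>T X s" for X
  proof (rule eq_scaled_of_combination[OF _ assms(15)])
    show "D\<^sub>T X s = cos \<theta> *\<^sub>R D\<^sub>T X s + sin \<theta> *\<^sub>R D\<^sub>B X s"
      using assms(18)[rule_format, OF that(1) s] by (simp only: that(2))
  qed
  \<comment> \<open>The derivative of \<open>T\<close> in the direction \<open>B\<close> is a
    multiple of \<open>N\<close> and is left unchanged by the projection. That of \<open>N\<close>
    is a multiple of \<open>- \<kappa> s *\<^sub>R T s + \<tau> s *\<^sub>R B s\<close>, and the
    projection removes exactly its torsion term.\<close>
  show "normal_connection B D\<^sub>B T s = (((1 - cos \<theta>) / sin \<theta>) * \<kappa> s) *\<^sub>R N s \<and>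
        normal_connection B D\<^sub>B N s = - (((1 - cos \<theta>) / sin \<theta>) * \<kappa> s) *\<^sub>R T s"
    unfolding normal_connection_def DB[OF frame_span_frame(1) DbT] DB[OF frame_span_frame(2) DbN] Da
    by (simp add: inner_simps fp scaleR_add_right scaleR_diff_right del: times_divide_eq_left)
qed

end
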